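(* Let $k$ be an algebraically closed field of characteristic $0$. Let $n,m$ be integers with $2\le n<m$ and let $\Theta\in\Sigma_n$. Then $\mathcal A_m(\Theta)=\{\Xi\in\Sigma_m\mid\Xi\le_p\Theta\}$ is a subvariety of $\Sigma_m$.
   Context: For $A,B\subseteq k$, $A\le_p B$ means that there is a polynomial $P\in k[X]$ with $A=P^{-1}(B)$; $A\equiv_p B$ means $A\le_p B$ and $B\le_p A$; $[A]$ is the $\equiv_p$-class of $A$; $[A]\le_p[B]$ iff $A\le_p B$. $\mathcal P_n$ is the set of $n$-element subsets of $k$, and $\Sigma_n=\{[A]\mid A\in\mathcal P_n\}$. Two elements of $\mathcal P_n$ are $\equiv_p$-equivalent if and only if one is the image of the other under a linear polynomial $cX+c'$ with $c\neq 0$. Variety structures: let $f_n=\prod_{j\ne j'}(X_j-X_{j'})$ and let $D(f_n)\subseteq k^n$ be the open set of points with pairwise distinct coordinates, an affine variety with ring of regular functions $k[X_1,\ldots,X_n]_{f_n}$. $\mathcal P_n$ is the affine variety obtained as the geometric quotient of $D(f_n)$ by the symmetric group $Sym_n$ permuting coordinates; its regular functions are the $Sym_n$-invariant regular functions on $D(f_n)$. $\Sigma_n$ is the affine variety obtained as the geometric quotient of $\mathcal P_n$ by the action $(P,A)\mapsto P(A)$ of the group of linear polynomials: it has the quotient topology (so a subset of $\Sigma_n$ is closed iff its preimage under $D(f_n)\to\Sigma_n$, $(a_1,\ldots,a_n)\mapsto[\{a_1,\ldots,a_n\}]$, is closed in $D(f_n)$), and its regular functions are the regular functions on $\mathcal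 P_n$ invariant under this action. A subvariety is a (possibly empty, possibly reducible) Zariski closed subset. *)

theory Defs
  imports
    "HOL-Analysis.Abstract_Topology"
    "HOL-Library.FuncSet"
    "HOL-Library.Poly_Mapping"
    "HOL-Computational_Algebra.Polynomial"
begin

section \<open>Polynomial reducibility\<close>

definition poly_le :: "'k::comm_ring_1 set \<Rightarrow> 'k set \<Rightarrow> bool"  (infix "\<le>\<^sub>p" 50)
  where "A \<le>\<^sub>p B \<longleftrightarrow> (\<exists>P :: 'k poly. A = poly P -` B)"

definition poly_equiv :: "'k::comm_ring_1 set \<Rightarrow> 'k set \<Rightarrow> bool"  (infix "\<equiv>\<^sub>p" 50)
  where "A \<equiv>\<^sub>p B \<longleftrightarrow> A \<le>\<^sub>p B \<and> B \<le>\<^sub>p A"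

definition poly_class :: "'k::comm_ring_1 set \<Rightarrow> 'k set set"
  where "poly_class A = {B. A \<equiv>\<^sub>p B}"

definition class_le :: "'k::comm_ring_1 set set \<Rightarrow> 'k set set \<Rightarrow> bool"  (infix "\<le>\<^sub>c" 50)
  where "\<Xi> \<le>\<^sub>c \<Theta> \<longleftrightarrow> (\<exists>A\<in>\<Xi>. \<exists>B\<in>\<Theta>. A \<le>\<^sub>p B)"

lemma poly_le_refl: "A \<le>\<^sub>p A"
  unfolding poly_le_def by (rule exI[of _ "[:0, 1:]"]) auto

lemma poly_le_trans:
  assumes "A \<le>\<^sub>p B" "B \<le>\<^sub>p C"
  shows "A \<le>\<^sub>p C"
proof -
  from assms obtain P Q where "A = poly P -` B" "B = poly Q -` C"
    unfolding poly_le_def by blast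
  then have "A = poly (pcompose Q P) -` C"
    by (auto simp: poly_pcompose)
  then show ?thesis
    unfolding poly_le_def by blast
qed

lemma poly_class_eq_iff: "poly_class A = poly_class B \<longleftrightarrow> A \<equiv>\<^sub>p B"
  unfolding poly_class_def poly_equiv_def set_eq_iff mem_Collect_eq
  using poly_le_refl poly_le_trans by meson

lemma class_le_poly_class_iff: "poly_class A \<le>\<^sub>c poly_class B \<longleftrightarrow> A \<le>\<^sub>p B"
  unfolding class_le_def poly_class_def poly_equiv_def Bex_def mem_Collect_eq
  using poly_le_refl poly_le_trans by meson

definition subsets_of_size :: "nat \<Rightarrow> 'k set set"
  where "subsets_of_size n = {A. finite A \<and> card A = n}"

definition classes_of_size :: "nat \<Rightarrow> 'k::comm_ring_1 set set set"
  where "classes_of_size n = poly_class ` subsets_of_size n"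


section \<open>Multivariate polynomials and the Zariski topology on affine space\<close>

text \<open>
  Polynomials in the variables \<open>X\<^sub>0, X\<^sub>1, \<dots>\<close> are finitely supported maps from exponent
  vectors to coefficients; points of affine \<open>n\<close>-space are functions on \<open>{..<n}\<close>.
\<close>

type_synonym 'k mpolynomial = "(nat \<Rightarrow>\<^sub>0 nat) \<Rightarrow>\<^sub>0 'k"

definition mvar :: "nat \<Rightarrow> 'k::comm_ring_1 mpolynomial"
  where "mvar i = Poly_Mapping.single (Poly_Mapping.single i 1) 1"

definition monom_eval :: "(nat \<Rightarrow> 'k::comm_ring_1) \<Rightarrow> (nat \<Rightarrow>\<^sub>0 nat) \<Rightarrow> 'k"
  where "monom_eval x t = (\<Prod>i\<in>Poly_Mapping.keys t. x i ^ Poly_Mapping.lookup t i)"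

definition mpoly_eval :: "(nat \<Rightarrow> 'k::comm_ring_1) \<Rightarrow> 'k mpolynomial \<Rightarrow> 'k"
  where "mpoly_eval x p = (\<Sum>t\<in>Poly_Mapping.keys p. Poly_Mapping.lookup p t * monom_eval x t)"

definition mpolys :: "nat \<Rightarrow> 'k::comm_ring_1 mpolynomial set"
  where "mpolys n = {p. \<forall>t\<in>Poly_Mapping.keys p. Poly_Mapping.keys t \<subseteq> {..<n}}"

definition affine_space :: "nat \<Rightarrow> (nat \<Rightarrow> 'k) set"
  where "affine_space n = {..<n} \<rightarrow>\<^sub>E UNIV"

definition zero_set :: "nat \<Rightarrow> 'k::comm_ring_1 mpolynomial set \<Rightarrow> (nat \<Rightarrow> 'k) set"
  where "zero_set n S = {x \<in> affine_space n. \<forall>p\<in>S. mpoly_eval x p = 0}"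

definition zariski_topology :: "nat \<Rightarrow> (nat \<Rightarrow> 'k::idom) topology"
  where "zariski_topology n = topology (\<lambda>U. \<exists>S\<subseteq>mpolys n. U = affine_space n - zero_set n S)"

lemma monom_eval_superset:
  assumes "finite I" "Poly_Mapping.keys t \<subseteq> I"
  shows "monom_eval x t = (\<Prod>i\<in>I. x i ^ Poly_Mapping.lookup t i)"
  unfolding monom_eval_def
  by (rule prod.mono_neutral_left) (use assms in \<open>auto simp: in_keys_iff\<close>)

lemma monom_eval_add: "monom_eval x (s + t) = monom_eval x s * monom_eval x t"
proof -
  let ?I = "Poly_Mapping.keys s \<union> Poly_Mapping.keys t"
  have "monom_eval x (s + t) = (\<Prod>i\<in>?I. x i ^ Poly_Mapping.lookup (s + t) i)"
    by (rule monom_eval_superset) (auto simp: keys_add)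
  also have "\<dots> = (\<Prod>i\<in>?I. x i ^ Poly_Mapping.lookup s i) * (\<Prod>i\<in>?I. x i ^ Poly_Mapping.lookup t i)"
    by (simp add: lookup_add power_add prod.distrib)
  also have "\<dots> = monom_eval x s * monom_eval x t"
    by (simp add: monom_eval_superset[of ?I])
  finally show ?thesis .
qed

lemma mpoly_eval_superset:
  assumes "finite I" "Poly_Mapping.keys p \<subseteq> I"
  shows "mpoly_eval x p = (\<Sum>t\<in>I. Poly_Mapping.lookup p t * monom_eval x t)"
  unfolding mpoly_eval_def
  by (rule sum.mono_neutral_left) (use assms in \<open>auto simp: in_keys_iff\<close>)

lemma mpoly_eval_single: "mpoly_eval x (Poly_Mapping.single t c) = c * monom_eval x t"
  by (subst mpoly_eval_superset[of "{t}"]) auto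

lemma mpoly_eval_0 [simp]: "mpoly_eval x 0 = 0"
  by (simp add: mpoly_eval_def)

lemma mpoly_eval_1 [simp]: "mpoly_eval x 1 = 1"
  by (simp add: mpoly_eval_def monom_eval_def lookup_one)

lemma mpoly_eval_mvar [simp]: "mpoly_eval x (mvar i) = x i"
  by (simp add: mvar_def mpoly_eval_single monom_eval_def)

lemma mpoly_eval_add [simp]: "mpoly_eval x (p + q) = mpoly_eval x p + mpoly_eval x q"
proof -
  let ?I = "Poly_Mapping.keys p \<union> Poly_Mapping.keys q"
  have "mpoly_eval x (p + q) = (\<Sum>t\<in>?I. Poly_Mapping.lookup (p + q) t * monom_eval x t)"
    by (rule mpoly_eval_superset) (auto simp: keys_add)
  also have "\<dots> = (\<Sum>t\<in>?I. Poly_Mapping.lookup p t * monom_eval x t)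
      + (\<Sum>t\<in>?I. Poly_Mapping.lookup q t * monom_eval x t)"
    by (simp add: lookup_add distrib_right sum.distrib)
  also have "\<dots> = mpoly_eval x p + mpoly_eval x q"
    by (simp add: mpoly_eval_superset[of ?I])
  finally show ?thesis .
qed

lemma mpoly_eval_diff [simp]: "mpoly_eval x (p - q) = mpoly_eval x p - mpoly_eval x q"
  using mpoly_eval_add[of x "p - q" q] by simp

lemma mpoly_induct [case_names zero add_single]:
  assumes "P 0"
    and "\<And>p t c. P p \<Longrightarrow> P (p + Poly_Mapping.single t c)"
  shows "P (p :: 'a \<Rightarrow>\<^sub>0 'b::ab_group_add)"
proof (induction p rule: update_induct)
  case const
  show ?case by (rule assms(1))
next
  case (update p t c)
  have "Poly_Mapping.update t c p = p + Poly_Mapping.single t c"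
    using update(1)
    by (intro poly_mapping_eqI)
      (auto simp: Poly_Mapping.lookup_update lookup_add lookup_single in_keys_iff when_def)
  with assms(2)[OF update(3)] show ?case by simp
qed

lemma mpoly_eval_mult [simp]: "mpoly_eval x (p * q) = mpoly_eval x p * mpoly_eval x q"
proof (induction p rule: mpoly_induct)
  case zero
  show ?case by simp
next
  case (add_single p s c)
  have "mpoly_eval x (Poly_Mapping.single s c * q) = mpoly_eval x (Poly_Mapping.single s c) * mpoly_eval x q"
    by (induction q rule: mpoly_induct)
      (simp_all add: distrib_left mult_single mpoly_eval_single monom_eval_add)
  with add_single show ?case
    by (simp add: distrib_right)
qed

lemma mpoly_eval_prod: "mpoly_eval x (\<Prod>i\<in>I. p i) = (\<Prod>i\<in>I. mpoly_eval x (p i))"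
  by (induction I rule: infinite_finite_induct) auto

lemma mpolys_mult:
  assumes "p \<in> mpolys n" "q \<in> mpolys n"
  shows "p * q \<in> mpolys n"
  unfolding mpolys_def
proof safe
  fix t i
  assume "t \<in> Poly_Mapping.keys (p * q)" and i: "i \<in> Poly_Mapping.keys t"
  then obtain a b where "t = a + b" "a \<in> Poly_Mapping.keys p" "b \<in> Poly_Mapping.keys q"
    using keys_mult[of p q] by blast
  with assms i keys_add[of a b] show "i < n"
    unfolding mpolys_def by blast
qed

lemma istopology_zariski:
  "istopology (\<lambda>U :: (nat \<Rightarrow> 'k::idom) set. \<exists>S\<subseteq>mpolys n. U = affine_space n - zero_set n S)"
  unfolding istopology_def
proof (intro conjI allI impI)
  fix U V :: "(nat \<Rightarrow> 'k) set"
  assume "\<exists>S\<subseteq>mpolys n. U = affine_space n - zero_set n S"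
    and "\<exists>S\<subseteq>mpolys n. V = affine_space n - zero_set n S"
  then obtain S T where S: "S \<subseteq> mpolys n" "U = affine_space n - zero_set n S"
    and T: "T \<subseteq> mpolys n" "V = affine_space n - zero_set n T"
    by blast
  let ?R = "(\<lambda>(p, q). p * q) ` (S \<times> T)"
  have "?R \<subseteq> mpolys n"
    using S(1) T(1) by (auto intro: mpolys_mult)
  moreover have "U \<inter> V = affine_space n - zero_set n ?R"
    unfolding S(2) T(2) zero_set_def by fastforce
  ultimately show "\<exists>S\<subseteq>mpolys n. U \<inter> V = affine_space n - zero_set n S"
    by blast
next
  fix K :: "(nat \<Rightarrow> 'k) set set"
  assume "\<forall>U\<in>K. \<exists>S\<subseteq>mpolys n. U = affine_space n - zero_set n S"
  then obtain S where S: "\<And>U. U \<in> K \<Longrightarrow> S U \<subseteq> mpolys n \<and> U = affine_space n - zero_set n (S U)"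
    by metis
  have "\<Union> K = (\<Union>U\<in>K. affine_space n - zero_set n (S U))"
    using S by blast
  also have "\<dots> = affine_space n - zero_set n (\<Union>U\<in>K. S U)"
    unfolding zero_set_def by blast
  finally show "\<exists>S\<subseteq>mpolys n. \<Union> K = affine_space n - zero_set n S"
    using S by (intro exI[of _ "\<Union>U\<in>K. S U"]) blast
qed

lemma openin_zariski_topology:
  "openin (zariski_topology n) U \<longleftrightarrow> (\<exists>S\<subseteq>mpolys n. U = affine_space n - zero_set n S)"
  unfolding zariski_topology_def by (simp add: istopology_zariski)

lemma topspace_zariski_topology [simp]: "topspace (zariski_topology n) = affine_space n"
proof -
  have "{1} \<subseteq> mpolys n" "affine_space n = affine_space n - zero_set n {1 :: 'a mpolynomial}"
    by (auto simp: mpolys_def zero_set_def)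
  then have "openin (zariski_topology n) (affine_space n :: (nat \<Rightarrow> 'a) set)"
    unfolding openin_zariski_topology by blast
  moreover have "U \<subseteq> affine_space n" if "openin (zariski_topology n) U" for U :: "(nat \<Rightarrow> 'a) set"
    using that unfolding openin_zariski_topology by blast
  ultimately show ?thesis
    unfolding topspace_def by blast
qed

lemma closedin_zariski_topology:
  "closedin (zariski_topology n) Z \<longleftrightarrow> (\<exists>S\<subseteq>mpolys n. Z = zero_set n S)"
proof -
  have "zero_set n S \<subseteq> affine_space n" for S :: "'a mpolynomial set"
    by (auto simp: zero_set_def)
  then show ?thesis
    unfolding closedin_def openin_zariski_topology topspace_zariski_topology
    by (metis Diff_subset double_diff order_refl)
qed


section \<open>The spaces of finite subsets and of their classes\<close>

definition quotient_topology :: "'a topology \<Rightarrow> ('a \<Rightarrow> 'b) \<Rightarrow> 'b topology"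
  where "quotient_topology X f =
    topology (\<lambda>U. U \<subseteq> f ` topspace X \<and> openin X {x \<in> topspace X. f x \<in> U})"

lemma istopology_quotient_topology:
  "istopology (\<lambda>U. U \<subseteq> f ` topspace X \<and> openin X {x \<in> topspace X. f x \<in> U})"
  unfolding istopology_def
proof (intro conjI allI impI)
  fix U V
  assume "U \<subseteq> f ` topspace X \<and> openin X {x \<in> topspace X. f x \<in> U}"
    and "V \<subseteq> f ` topspace X \<and> openin X {x \<in> topspace X. f x \<in> V}"
  moreover have "{x \<in> topspace X. f x \<in> U \<inter> V} = {x \<in> topspace X. f x \<in> U} \<inter> {x \<in> topspace X. f x \<in> V}"
    by blast
  ultimately show "U \<inter> V \<subseteq> f ` topspace X" "openin X {x \<in> topspace X. f x \<in> U \<inter> V}"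
    by (auto intro: openin_Int)
next
  fix K
  assume *: "\<forall>U\<in>K. U \<subseteq> f ` topspace X \<and> openin X {x \<in> topspace X. f x \<in> U}"
  then show "\<Union> K \<subseteq> f ` topspace X"
    by blast
  have "{x \<in> topspace X. f x \<in> \<Union> K} = (\<Union>U\<in>K. {x \<in> topspace X. f x \<in> U})"
    by blast
  also have "openin X \<dots>"
    using * by blast
  finally show "openin X {x \<in> topspace X. f x \<in> \<Union> K}" .
qed

lemma openin_quotient_topology:
  "openin (quotient_topology X f) U \<longleftrightarrow>
    U \<subseteq> f ` topspace X \<and> openin X {x \<in> topspace X. f x \<in> U}"
  unfolding quotient_topology_def by (simp add: istopology_quotient_topology)

lemma topspace_quotient_topology [simp]: "topspace (quotient_topology X f) = f ` topspace X"
proof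
  show "topspace (quotient_topology X f) \<subseteq> f ` topspace X"
    unfolding topspace_def[of "quotient_topology X f"] openin_quotient_topology by blast
  have "{x \<in> topspace X. f x \<in> f ` topspace X} = topspace X"
    by blast
  then have "openin (quotient_topology X f) (f ` topspace X)"
    unfolding openin_quotient_topology by simp
  then show "f ` topspace X \<subseteq> topspace (quotient_topology X f)"
    by (rule openin_subset)
qed

lemma quotient_map_quotient_topology: "quotient_map X (quotient_topology X f) f"
  unfolding quotient_map_def by (auto simp: openin_quotient_topology)

definition discriminant_poly :: "nat \<Rightarrow> 'k::comm_ring_1 mpolynomial"
  where "discriminant_poly n =
    (\<Prod>(i, j) \<in> {(i, j). i < n \<and> j < n \<and> i \<noteq> j}. mvar i - mvar j)"

definition distinct_points :: "nat \<Rightarrow> (nat \<Rightarrow> 'k::comm_ring_1) set"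
  where "distinct_points n = {x \<in> affine_space n. mpoly_eval x (discriminant_poly n) \<noteq> 0}"

lemma distinct_points_iff:
  "x \<in> distinct_points n \<longleftrightarrow> x \<in> affine_space n \<and> inj_on x {..<n}"
  for x :: "nat \<Rightarrow> 'k::idom"
proof -
  have "finite {(i, j). i < n \<and> j < n \<and> i \<noteq> j}"
    by (rule finite_subset[of _ "{..<n} \<times> {..<n}"]) auto
  then have "mpoly_eval x (discriminant_poly n) \<noteq> 0 \<longleftrightarrow> inj_on x {..<n}"
    unfolding discriminant_poly_def mpoly_eval_prod
    by (auto simp: inj_on_def case_prod_unfold)
  then show ?thesis
    unfolding distinct_points_def by auto
qed

definition points_topology :: "nat \<Rightarrow> (nat \<Rightarrow> 'k::idom) topology"
  where "points_topology n = subtopology (zariski_topology n) (distinct_points n)"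

text \<open>
  The fibres of \<open>x \<mapsto> x ` {..<n}\<close> on points with distinct coordinates are the orbits of the
  symmetric group.
\<close>

definition subsets_topology :: "nat \<Rightarrow> 'k::idom set topology"
  where "subsets_topology n = quotient_topology (points_topology n) (\<lambda>x. x ` {..<n})"

text \<open>
  Over an algebraically closed field of characteristic 0, the fibres of \<^const>\<open>poly_class\<close> on
  \<open>n\<close>-element subsets are the orbits of the group of polynomials \<open>c X + c'\<close> with \<open>c \<noteq> 0\<close>.
\<close>

definition classes_topology :: "nat \<Rightarrow> 'k::idom set set topology"
  where "classes_topology n = quotient_topology (subsets_topology n) poly_class"

lemma topspace_points_topology [simp]: "topspace (points_topology n) = distinct_points n"
  by (auto simp: points_topology_def distinct_points_def)

lemma image_distinct_points:
  "(\<lambda>x. x ` {..<n}) ` distinct_points n = (subsets_of_size n :: 'k::idom set set)"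
proof (intro equalityI subsetI)
  fix A :: "'k set"
  assume "A \<in> (\<lambda>x. x ` {..<n}) ` distinct_points n"
  then show "A \<in> subsets_of_size n"
    by (auto simp: subsets_of_size_def distinct_points_iff card_image)
next
  fix A :: "'k set"
  assume "A \<in> subsets_of_size n"
  then obtain h where h: "bij_betw h {..<n} A"
    unfolding subsets_of_size_def
    using ex_bij_betw_nat_finite[of A] by (auto simp: atLeast0LessThan)
  have "restrict h {..<n} \<in> distinct_points n"
    using h by (auto simp: distinct_points_iff affine_space_def bij_betw_def inj_on_def)
  moreover have "A = restrict h {..<n} ` {..<n}"
    using h by (auto simp: bij_betw_def)
  ultimately show "A \<in> (\<lambda>x. x ` {..<n}) ` distinct_points n"
    by blast
qed

lemma topspace_subsets_topology [simp]: "topspace (subsets_topology n) = subsets_of_size n"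
  by (simp add: subsets_topology_def image_distinct_points)

lemma topspace_classes_topology [simp]: "topspace (classes_topology n) = classes_of_size n"
  by (simp add: classes_topology_def classes_of_size_def)

lemma closedin_classes_topology:
  "closedin (classes_topology n) Z \<longleftrightarrow>
    Z \<subseteq> classes_of_size n \<and>
    closedin (points_topology n) {x \<in> distinct_points n. poly_class (x ` {..<n}) \<in> Z}"
  for Z :: "'k::idom set set set"
proof -
  have "quotient_map (points_topology n) (classes_topology n :: 'k set set topology)
      (poly_class \<circ> (\<lambda>x. x ` {..<n}))"
    unfolding classes_topology_def subsets_topology_def
    by (rule quotient_map_compose[OF quotient_map_quotient_topology quotient_map_quotient_topology])
  then have "\<forall>U\<subseteq>classes_of_size n :: 'k set set set.
      closedin (points_topology n) {x \<in> distinct_points n. poly_class (x ` {..<n}) \<in> U} =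
      closedin (classes_topology n) U"
    unfolding quotient_map_closedin by simp
  moreover have "Z \<subseteq> classes_of_size n" if "closedin (classes_topology n) Z"
    using closedin_subset[OF that] by simp
  ultimately show ?thesis
    by auto
qed

definition classes_below :: "nat \<Rightarrow> 'k::comm_ring_1 set set \<Rightarrow> 'k set set set"
  where "classes_below m \<Theta> = {\<Xi> \<in> classes_of_size m. \<Xi> \<le>\<^sub>c \<Theta>}"

end

theory Submission
  imports Defs
begin

text \<open>
  Write \<open>\<Theta> = [B]\<close> and let \<open>x = (x\<^sub>0, \<dots>, x\<^bsub>m-1\<^esub>)\<close> have pairwise distinct coordinates. What has
  to be shown is that the condition \<open>{x\<^sub>i} = P -` B\<close> for some polynomial \<open>P\<close> is closed in \<open>x\<close>.

  If such a \<open>P\<close> exists, it is not constant, and it induces the discrete data \<open>s i = P(x\<^sub>i) \<in> B\<close>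
  (which fibre contains \<open>x\<^sub>i\<close>) and \<open>e i \<ge> 1\<close> (with which multiplicity). Over an algebraically
  closed field these data determine \<open>P - b = c Q\<^sub>b\<close> for all \<open>b \<in> B\<close>, where
  \<open>Q\<^sub>b = \<Prod>\<^bsub>s i = b\<^esub> (X - x\<^sub>i) ^ e i\<close> and \<open>c\<close> is the leading coefficient of \<open>P\<close>. Conversely,
  given \<open>s\<close> and \<open>e\<close>, a suitable \<open>P\<close> exists as soon as there is \<open>c \<noteq> 0\<close> with
  \<open>c (Q\<^sub>b - Q\<^bsub>b0\<^esub>) = b0 - b\<close> for all \<open>b \<in> B\<close>. Fixing two elements \<open>b0 \<noteq> b1\<close> of \<open>B\<close>, the
  scalar \<open>c\<close> can be eliminated: the condition becomes
  \<open>(b0 - b1) (Q\<^sub>b - Q\<^bsub>b0\<^esub>) = (b0 - b) g\<close>, where \<open>g\<close> is the constant term of \<open>Q\<^bsub>b1\<^esub> - Q\<^bsub>b0\<^esub>\<close>.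
  The number \<open>g\<close> cannot vanish, because \<open>Q\<^bsub>b0\<^esub>\<close> and \<open>Q\<^bsub>b1\<^esub>\<close> have no common root, while \<open>Q\<^bsub>b0\<^esub>\<close>
  has a root if \<open>s\<close> takes the value \<open>b0\<close>; so no open condition on \<open>x\<close> remains.
  Comparing coefficients gives polynomial equations in \<open>x\<close>; this is
  \<open>poly_le_iff_fibre_condition\<close>.

  It remains to see that finitely many \<open>(s, e)\<close> suffice, that is, to bound \<open>deg P\<close> in terms of
  \<open>m\<close>. In characteristic 0, a point of multiplicity \<open>e\<close> in a fibre is a root of \<open>P'\<close> of order
  \<open>e - 1\<close>, so \<open>card B * deg P \<le> m + (deg P - 1)\<close>; this is the Riemann--Hurwitz estimate
  \<open>card_vimage_poly_ge\<close>. Since \<open>B\<close> has at least two elements, \<open>deg P < m\<close>,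
  and all multiplicities lie in \<open>{1..m}\<close>.
\<close>


section \<open>Multiplicities of roots\<close>

lemma alg_closed_factorization_proots:
  fixes q :: "'a::alg_closed_field poly"
  assumes "q \<noteq> 0"
  shows "size (proots q) = degree q"
    and "q = smult (lead_coeff q) (\<Prod>x\<in>#proots q. [:- x, 1:])"
proof -
  obtain A where A: "size A = degree q" "q = smult (lead_coeff q) (\<Prod>x\<in>#A. [:- x, 1:])"
    using alg_closed_imp_factorization[OF assms] by blast
  have "proots q = proots (\<Prod>x\<in>#A. [:- x, 1:])"
    using assms by (subst A(2)) simp
  also have "\<dots> = A"
  proof (induction A)
    case (add a A)
    have "(\<Prod>x\<in>#A. [:- x, 1:]) \<noteq> 0"
      by auto
    with add show ?case
      by (simp add: proots_mult del: mult_pCons_left)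
  qed simp
  finally show "size (proots q) = degree q"
    and "q = smult (lead_coeff q) (\<Prod>x\<in>#proots q. [:- x, 1:])"
    using A by auto
qed

lemma alg_closed_factorization_order:
  fixes q :: "'a::alg_closed_field poly"
  assumes "q \<noteq> 0"
  shows "q = smult (lead_coeff q) (\<Prod>x | poly q x = 0. [:- x, 1:] ^ order x q)"
  using alg_closed_factorization_proots(2)[OF assms] assms
  by (simp add: image_prod_mset_multiplicity)

lemma sum_order_eq_degree:
  fixes q :: "'a::alg_closed_field poly"
  assumes "q \<noteq> 0"
  shows "(\<Sum>x | poly q x = 0. order x q) = degree q"
  using alg_closed_factorization_proots(1)[OF assms] assms
  by (simp add: size_multiset_overloaded_eq)

lemma sum_order_le_degree:
  fixes q :: "'a::idom poly"
  assumes "q \<noteq> 0" "finite A"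
  shows "(\<Sum>x\<in>A. order x q) \<le> degree q"
proof -
  have "(\<Sum>x\<in>A. order x q) = (\<Sum>x\<in>A \<inter> {x. poly q x = 0}. order x q)"
    using assms by (intro sum.mono_neutral_right) (auto simp: order_eq_0_iff)
  also have "\<dots> \<le> (\<Sum>x | poly q x = 0. order x q)"
    using assms by (intro sum_mono2) (auto simp: poly_roots_finite)
  also have "\<dots> = size (proots q)"
    using assms by (simp add: size_multiset_overloaded_eq)
  finally show ?thesis
    using size_proots_le[of q] by linarith
qed

lemma degree_minus_const [simp]: "degree (P - [:b:]) = degree P"
  for P :: "'a::comm_ring_1 poly"
proof (cases "degree P = 0")
  case True
  then obtain a where "P = [:a:]"
    using degree_eq_zeroE by blast
  then show ?thesis by simp
next
  case False
  then show ?thesis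
    using degree_add_eq_left[of "- [:b:]" P] by (simp del: minus_pCons)
qed

lemma lead_coeff_minus_const:
  fixes P :: "'a::comm_ring_1 poly"
  assumes "degree P > 0"
  shows "lead_coeff (P - [:b:]) = lead_coeff P"
  using assms by (cases "degree P") simp_all

text \<open>
  This is Riemann--Hurwitz for a polynomial map: counted with multiplicity the fibres over \<open>B\<close>
  have \<open>card B * degree P\<close> points, and the surplus over the actual number of points is
  the number of critical points in these fibres, at most \<open>degree P - 1\<close>.
\<close>

lemma card_vimage_poly_ge:
  fixes P :: "'k::{alg_closed_field, field_char_0} poly"
  assumes "degree P > 0" and fin: "finite B" "finite (poly P -` B)"
  shows "card B * degree P \<le> card (poly P -` B) + (degree P - 1)"
proof -
  let ?A = "poly P -` B"
  have nz: "P - [:b:] \<noteq> 0" for b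
    using assms(1) degree_minus_const[of P b] by (metis degree_0 less_numeral_extra(3))
  have "pderiv P \<noteq> 0"
    using assms(1) by (simp add: pderiv_eq_0_iff)
  have "card B * degree P = (\<Sum>b\<in>B. degree (P - [:b:]))"
    by simp
  also have "\<dots> = (\<Sum>b\<in>B. \<Sum>x | poly (P - [:b:]) x = 0. order x (P - [:b:]))"
    using nz by (simp only: sum_order_eq_degree[OF nz])
  also have "\<dots> = (\<Sum>b\<in>B. \<Sum>x | x \<in> ?A \<and> poly P x = b. order x (P - [:poly P x:]))"
    by (intro sum.cong) auto
  also have "\<dots> = (\<Sum>x\<in>?A. order x (P - [:poly P x:]))"
    using fin by (intro sum.group) auto
  also have "\<dots> = (\<Sum>x\<in>?A. Suc (order x (pderiv P)))"
  proof (intro sum.cong refl)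
    fix x
    show "order x (P - [:poly P x:]) = Suc (order x (pderiv P))"
      using order_pderiv[OF nz[of "poly P x"], of x] by (simp add: pderiv_diff pderiv_pCons)
  qed
  also have "\<dots> = card ?A + (\<Sum>x\<in>?A. order x (pderiv P))"
    by (simp add: sum_Suc)
  also have "(\<Sum>x\<in>?A. order x (pderiv P)) \<le> degree P - 1"
    using sum_order_le_degree[OF \<open>pderiv P \<noteq> 0\<close> fin(2)] by (simp add: degree_pderiv)
  finally show ?thesis by simp
qed

lemma degree_less_card_vimage:
  fixes P :: "'k::{alg_closed_field, field_char_0} poly"
  assumes "degree P > 0" and fin: "finite B" "finite (poly P -` B)" and "2 \<le> card B"
  shows "degree P < card (poly P -` B)"
proof -
  have "2 * degree P \<le> card B * degree P"
    using assms(4) by simp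
  then show ?thesis
    using card_vimage_poly_ge[OF assms(1) fin] assms(1) by linarith
qed


section \<open>Eliminating the polynomial\<close>

text \<open>
  Up to a scalar this is \<open>P - b\<close>, if \<open>s i\<close> is the value of \<open>P\<close> at \<open>x i\<close> and \<open>e i\<close> the
  multiplicity with which it is taken there.
\<close>

definition fibre_poly ::
    "nat \<Rightarrow> (nat \<Rightarrow> 'k) \<Rightarrow> (nat \<Rightarrow> nat) \<Rightarrow> (nat \<Rightarrow> 'k) \<Rightarrow> 'k \<Rightarrow> 'k::comm_ring_1 poly"
  where "fibre_poly m s e x b = (\<Prod>i | i < m \<and> s i = b. [:- x i, 1:] ^ e i)"

text \<open>
  The condition says that the \<open>fibre_poly m s e x b\<close> differ from each other by constants, and that
  these constants are proportional to the differences of the elements of \<open>B\<close>.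
\<close>

definition fibre_condition ::
    "nat \<Rightarrow> 'k set \<Rightarrow> 'k \<Rightarrow> 'k \<Rightarrow> (nat \<Rightarrow> 'k) \<Rightarrow> (nat \<Rightarrow> nat) \<Rightarrow> (nat \<Rightarrow> 'k::comm_ring_1) \<Rightarrow> bool"
  where "fibre_condition m B b0 b1 s e x \<longleftrightarrow>
    (\<forall>b\<in>B. smult (b0 - b1) (fibre_poly m s e x b - fibre_poly m s e x b0) =
      [:(b0 - b) * coeff (fibre_poly m s e x b1 - fibre_poly m s e x b0) 0:])"

lemma poly_fibre_poly_eq_0_iff:
  fixes x :: "nat \<Rightarrow> 'k::idom"
  assumes "\<And>i. i < m \<Longrightarrow> e i > 0"
  shows "poly (fibre_poly m s e x b) y = 0 \<longleftrightarrow> (\<exists>i<m. s i = b \<and> y = x i)"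
  using assms unfolding fibre_poly_def by (auto simp: poly_prod)

text \<open>
  With \<open>Q\<^sub>b\<close> for the fibre polynomials, \<open>P = b0 + c Q\<^bsub>b0\<^esub>\<close> is the witness, where \<open>c\<close> is forced to be
  \<open>(b0 - b1) / g\<close>, \<open>g\<close> being the constant \<open>Q\<^bsub>b1\<^esub> - Q\<^bsub>b0\<^esub>\<close>. The division makes
  sense because \<open>Q\<^bsub>b0\<^esub>\<close> has a root, \<open>s\<close> taking the value \<open>b0\<close>, and shares none with \<open>Q\<^bsub>b1\<^esub>\<close>, \<open>x\<close> being injective.
\<close>

lemma fibre_condition_imp_poly_le:
  fixes x :: "nat \<Rightarrow> 'k::field"
  assumes inj: "inj_on x {..<m}" and "b1 \<in> B" "b0 \<noteq> b1"
    and s: "s \<in> {..<m} \<rightarrow> B" "b0 \<in> s ` {..<m}" and e: "\<And>i. i < m \<Longrightarrow> e i > 0"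
    and cond: "fibre_condition m B b0 b1 s e x"
  shows "x ` {..<m} \<le>\<^sub>p B"
proof -
  define Q where "Q = fibre_poly m s e x"
  define g where "g = coeff (Q b1 - Q b0) 0"
  define c where "c = (b0 - b1) / g"
  define P where "P = [:b0:] + smult c (Q b0)"
  have Q0: "poly (Q b) y = 0 \<longleftrightarrow> (\<exists>i<m. s i = b \<and> y = x i)" for b y
    unfolding Q_def using e by (rule poly_fibre_poly_eq_0_iff)
  have cond: "smult (b0 - b1) (Q b - Q b0) = [:(b0 - b) * g:]" if "b \<in> B" for b
    using cond that unfolding fibre_condition_def g_def Q_def by blast
  have "g \<noteq> 0"
  proof
    assume "g = 0"
    then have "Q b1 = Q b0"
      using cond[OF \<open>b1 \<in> B\<close>] \<open>b0 \<noteq> b1\<close> by simp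
    moreover obtain i where i: "i < m" "s i = b0"
      using s(2) by auto
    ultimately have "poly (Q b1) (x i) = 0"
      using Q0[of b0] by auto
    then obtain j where "j < m" "s j = b1" "x i = x j"
      using Q0[of b1] by auto
    with i inj \<open>b0 \<noteq> b1\<close> show False
      by (auto dest: inj_onD)
  qed
  then have "c \<noteq> 0"
    using \<open>b0 \<noteq> b1\<close> by (simp add: c_def)
  have PQ: "poly P y - b = c * poly (Q b) y" if "b \<in> B" for b y
  proof -
    have "(b0 - b1) * (poly (Q b) y - poly (Q b0) y) = (b0 - b) * g"
      using arg_cong[OF cond[OF that], of "\<lambda>p. poly p y"] by simp
    then have "c * (poly (Q b) y - poly (Q b0) y) = b0 - b"
      using \<open>g \<noteq> 0\<close> by (simp add: c_def field_simps)
    then show ?thesis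
      by (simp add: P_def algebra_simps)
  qed
  have "poly P y \<in> B \<longleftrightarrow> (\<exists>i<m. y = x i)" for y
  proof -
    have "poly P y \<in> B \<longleftrightarrow> (\<exists>b\<in>B. poly P y - b = 0)"
      by auto
    also have "\<dots> \<longleftrightarrow> (\<exists>b\<in>B. poly (Q b) y = 0)"
      using PQ \<open>c \<noteq> 0\<close> by auto
    finally show ?thesis
      using Q0 s(1) by (auto simp: Pi_iff)
  qed
  then have "x ` {..<m} = poly P -` B"
    by auto
  then show ?thesis
    unfolding poly_le_def by blast
qed

text \<open>
  The witnesses are the values and multiplicities of a reducing polynomial \<open>P\<close> at the points
  \<open>x i\<close>. Algebraic closedness enters twice: \<open>P - b\<close> is determined by its roots with
  multiplicities up to its leading coefficient, and \<open>P\<close> takes the value \<open>b0\<close>.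
\<close>

lemma poly_le_imp_fibre_condition:
  fixes x :: "nat \<Rightarrow> 'k::{alg_closed_field, field_char_0}"
  assumes inj: "inj_on x {..<m}" and "m > 0" and B: "finite B" "b0 \<in> B" "b1 \<in> B" "b0 \<noteq> b1"
    and le: "x ` {..<m} \<le>\<^sub>p B"
  shows "\<exists>s\<in>{..<m} \<rightarrow>\<^sub>E B. \<exists>e\<in>{..<m} \<rightarrow>\<^sub>E {1..m}.
    b0 \<in> s ` {..<m} \<and> fibre_condition m B b0 b1 s e x"
proof -
  obtain P where P: "x ` {..<m} = poly P -` B"
    using le unfolding poly_le_def by blast
  have fin: "finite (poly P -` B)" and card: "card (poly P -` B) = m"
    using card_image[OF inj] by (auto simp flip: P)
  \<comment> \<open>The preimage under a constant polynomial is empty or the whole field, which is infinite.\<close>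
  have deg: "degree P > 0"
  proof (rule ccontr)
    assume "\<not> degree P > 0"
    then obtain a where "P = [:a:]"
      using degree_eq_zeroE by blast
    then have "poly P -` B = {} \<or> poly P -` B = UNIV"
      by auto
    then show False
      using P fin \<open>m > 0\<close> infinite_UNIV_char_0[where 'a = 'k] by auto
  qed
  have nz: "P - [:b:] \<noteq> 0" for b
    using deg degree_minus_const[of P b] by (metis degree_0 less_numeral_extra(3))
  have "2 \<le> card B"
    using B card_mono[of B "{b0, b1}"] by simp
  then have "degree P < m"
    using degree_less_card_vimage[OF deg B(1) fin] card by simp

  define s where "s = restrict (\<lambda>i. poly P (x i)) {..<m}"
  define e where "e = restrict (\<lambda>i. order (x i) (P - [:poly P (x i):])) {..<m}"
  define c where "c = lead_coeff P"
  define Q where "Q = fibre_poly m s e x"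
  have "c \<noteq> 0"
    using deg by (auto simp: c_def)
  have s: "s \<in> {..<m} \<rightarrow>\<^sub>E B"
    using P by (auto simp: s_def)
  have e: "e \<in> {..<m} \<rightarrow>\<^sub>E {1..m}"
  proof -
    have "order (x i) (P - [:poly P (x i):]) \<in> {1..m}" for i
      using order_degree[OF nz, of "x i" "poly P (x i)"] \<open>degree P < m\<close>
        order_gt_0_iff[OF nz, of "x i" "poly P (x i)"] by (simp add: Suc_le_eq)
    then show ?thesis
      by (auto simp: e_def)
  qed
  have s0: "b0 \<in> s ` {..<m}"
  proof -
    obtain y where "poly (P - [:b0:]) y = 0"
      using alg_closed_imp_poly_has_root[of "P - [:b0:]"] deg by auto
    then have "poly P y = b0"
      by simp
    moreover obtain i where "i < m" "y = x i"
      using P \<open>b0 \<in> B\<close> \<open>poly P y = b0\<close> by blast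
    ultimately show ?thesis
      by (auto simp: s_def)
  qed
  have PQ: "P - [:b:] = smult c (Q b)" if "b \<in> B" for b
  proof -
    have "bij_betw x {i. i < m \<and> s i = b} {y. poly (P - [:b:]) y = 0}"
      unfolding bij_betw_def
    proof
      show "inj_on x {i. i < m \<and> s i = b}"
        using inj by (rule inj_on_subset) auto
      show "x ` {i. i < m \<and> s i = b} = {y. poly (P - [:b:]) y = 0}"
      proof (intro equalityI subsetI)
        fix y assume y: "y \<in> {y. poly (P - [:b:]) y = 0}"
        then have "y \<in> x ` {..<m}"
          using P that by simp
        then show "y \<in> x ` {i. i < m \<and> s i = b}"
          using y by (auto simp: s_def)
      qed (auto simp: s_def)
    qed
    then have "(\<Prod>y | poly (P - [:b:]) y = 0. [:- y, 1:] ^ order y (P - [:b:])) =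
        (\<Prod>i | i < m \<and> s i = b. [:- x i, 1:] ^ order (x i) (P - [:b:]))"
      by (rule prod.reindex_bij_betw[symmetric])
    also have "\<dots> = Q b"
      unfolding Q_def fibre_poly_def by (intro prod.cong) (auto simp: s_def e_def)
    finally show ?thesis
      using alg_closed_factorization_order[OF nz[of b]] lead_coeff_minus_const[OF deg]
      by (simp add: c_def)
  qed
  have diff: "smult c (Q b - Q b0) = [:b0 - b:]" if "b \<in> B" for b
    unfolding smult_diff_right PQ[OF that, symmetric] PQ[OF \<open>b0 \<in> B\<close>, symmetric] by simp
  have const: "Q b - Q b0 = [:(b0 - b) / c:]" if "b \<in> B" for b
    using arg_cong[OF diff[OF that], of "smult (inverse c)"] \<open>c \<noteq> 0\<close> by (simp add: field_simps)
  have "fibre_condition m B b0 b1 s e x"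
    unfolding fibre_condition_def Q_def[symmetric] using B by (simp add: const)
  with s e s0 show ?thesis by blast
qed

text \<open>
  The two preceding lemmas together express reducibility by finitely many choices of fibres and
  multiplicities and, for each choice, an identity between polynomials in one variable.
\<close>

lemma poly_le_iff_fibre_condition:
  fixes x :: "nat \<Rightarrow> 'k::{alg_closed_field, field_char_0}"
  assumes "inj_on x {..<m}" "m > 0" "finite B" "b0 \<in> B" "b1 \<in> B" "b0 \<noteq> b1"
  shows "x ` {..<m} \<le>\<^sub>p B \<longleftrightarrow>
    (\<exists>s\<in>{..<m} \<rightarrow>\<^sub>E B. \<exists>e\<in>{..<m} \<rightarrow>\<^sub>E {1..m}.
      b0 \<in> s ` {..<m} \<and> fibre_condition m B b0 b1 s e x)"
proof
  assume "\<exists>s\<in>{..<m} \<rightarrow>\<^sub>E B. \<exists>e\<in>{..<m} \<rightarrow>\<^sub>E {1..m}.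
    b0 \<in> s ` {..<m} \<and> fibre_condition m B b0 b1 s e x"
  then obtain s e where se: "s \<in> {..<m} \<rightarrow>\<^sub>E B" "e \<in> {..<m} \<rightarrow>\<^sub>E {1..m}"
    "b0 \<in> s ` {..<m}" "fibre_condition m B b0 b1 s e x"
    by blast
  have "s \<in> {..<m} \<rightarrow> B"
    using se(1) by (simp add: PiE_iff)
  moreover have "e i > 0" if "i < m" for i
    using PiE_mem[OF se(2), of i] that by simp
  ultimately show "x ` {..<m} \<le>\<^sub>p B"
    using assms(1,5,6) se(3,4) fibre_condition_imp_poly_le by blast
qed (use assms in \<open>rule poly_le_imp_fibre_condition\<close>)


section \<open>Polynomial functions and closed conditions\<close>

definition polynomial_fun :: "nat \<Rightarrow> ((nat \<Rightarrow> 'k::comm_ring_1) \<Rightarrow> 'k) \<Rightarrow> bool"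
  where "polynomial_fun n f \<longleftrightarrow> (\<exists>p\<in>mpolys n. \<forall>x. mpoly_eval x p = f x)"

lemma polynomial_fun_const: "polynomial_fun n (\<lambda>x. c)"
proof -
  have "Poly_Mapping.single 0 c \<in> mpolys n"
    by (auto simp: mpolys_def)
  moreover have "mpoly_eval x (Poly_Mapping.single 0 c) = c" for x
    by (simp add: mpoly_eval_single monom_eval_def)
  ultimately show ?thesis
    unfolding polynomial_fun_def by blast
qed

lemma polynomial_fun_var: "i < n \<Longrightarrow> polynomial_fun n (\<lambda>x. x i)"
  unfolding polynomial_fun_def
  by (rule bexI[of _ "mvar i"]) (simp, simp add: mpolys_def mvar_def)

lemma polynomial_fun_add:
  assumes "polynomial_fun n f" "polynomial_fun n g"
  shows "polynomial_fun n (\<lambda>x. f x + g x)"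
proof -
  obtain p q where "p \<in> mpolys n" "q \<in> mpolys n"
    and "\<And>x. mpoly_eval x p = f x" "\<And>x. mpoly_eval x q = g x"
    using assms unfolding polynomial_fun_def by blast
  moreover from this have "p + q \<in> mpolys n"
    using keys_add[of p q] unfolding mpolys_def by blast
  ultimately show ?thesis
    unfolding polynomial_fun_def by (intro bexI[of _ "p + q"]) auto
qed

lemma polynomial_fun_mult:
  assumes "polynomial_fun n f" "polynomial_fun n g"
  shows "polynomial_fun n (\<lambda>x. f x * g x)"
proof -
  obtain p q where "p \<in> mpolys n" "q \<in> mpolys n"
    and "\<And>x. mpoly_eval x p = f x" "\<And>x. mpoly_eval x q = g x"
    using assms unfolding polynomial_fun_def by blast
  then show ?thesis
    unfolding polynomial_fun_def by (intro bexI[of _ "p * q"]) (auto intro: mpolys_mult)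
qed

lemma polynomial_fun_uminus: "polynomial_fun n f \<Longrightarrow> polynomial_fun n (\<lambda>x. - f x)"
  using polynomial_fun_mult[OF polynomial_fun_const[of n "- 1"], of f] by simp

lemma polynomial_fun_diff:
  "polynomial_fun n f \<Longrightarrow> polynomial_fun n g \<Longrightarrow> polynomial_fun n (\<lambda>x. f x - g x)"
  using polynomial_fun_add[OF _ polynomial_fun_uminus, of n f g] by simp

lemma polynomial_fun_sum:
  "(\<And>i. i \<in> I \<Longrightarrow> polynomial_fun n (f i)) \<Longrightarrow> polynomial_fun n (\<lambda>x. \<Sum>i\<in>I. f i x)"
  by (induction I rule: infinite_finite_induct)
    (auto intro: polynomial_fun_const polynomial_fun_add)

lemma polynomial_fun_coeff_pCons:
  assumes "polynomial_fun n f" "\<And>k. polynomial_fun n (\<lambda>x. coeff (F x) k)"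
  shows "polynomial_fun n (\<lambda>x. coeff (pCons (f x) (F x)) k)"
  using assms by (cases k) simp_all

lemma polynomial_fun_coeff_mult:
  assumes "\<And>k. polynomial_fun n (\<lambda>x. coeff (F x) k)" "\<And>k. polynomial_fun n (\<lambda>x. coeff (G x) k)"
  shows "polynomial_fun n (\<lambda>x. coeff (F x * G x) k)"
  unfolding coeff_mult using assms by (intro polynomial_fun_sum polynomial_fun_mult)

lemma polynomial_fun_coeff_power:
  assumes "\<And>k. polynomial_fun n (\<lambda>x. coeff (F x) k)"
  shows "polynomial_fun n (\<lambda>x. coeff (F x ^ d) k)"
proof (induction d arbitrary: k)
  case 0
  show ?case
    by (simp add: polynomial_fun_const)
next
  case (Suc d)
  show ?case
    unfolding power_Suc by (rule polynomial_fun_coeff_mult[OF assms Suc])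
qed

lemma polynomial_fun_coeff_prod:
  assumes "\<And>i k. i \<in> I \<Longrightarrow> polynomial_fun n (\<lambda>x. coeff (F i x) k)"
  shows "polynomial_fun n (\<lambda>x. coeff (\<Prod>i\<in>I. F i x) k)"
  using assms
  by (induction I arbitrary: k rule: infinite_finite_induct)
    (auto intro: polynomial_fun_const polynomial_fun_coeff_mult)

lemma polynomial_fun_coeff_fibre_poly: "polynomial_fun m (\<lambda>x. coeff (fibre_poly m s e x b) k)"
  unfolding fibre_poly_def
proof (intro polynomial_fun_coeff_prod polynomial_fun_coeff_power)
  fix i k
  assume "i \<in> {i. i < m \<and> s i = b}"
  then show "polynomial_fun m (\<lambda>x. coeff [:- x i, 1:] k)"
    by (intro polynomial_fun_coeff_pCons polynomial_fun_uminus polynomial_fun_var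
        polynomial_fun_const) simp
qed

lemma closedin_polynomial_funs:
  fixes f :: "'i \<Rightarrow> (nat \<Rightarrow> 'k::idom) \<Rightarrow> 'k"
  assumes "\<And>i. i \<in> I \<Longrightarrow> polynomial_fun n (f i)"
  shows "closedin (zariski_topology n) {x \<in> affine_space n. \<forall>i\<in>I. f i x = 0}"
proof -
  obtain p where p: "\<And>i. i \<in> I \<Longrightarrow> p i \<in> mpolys n \<and> (\<forall>x. mpoly_eval x (p i) = f i x)"
    using assms unfolding polynomial_fun_def by metis
  then have "{x \<in> affine_space n. \<forall>i\<in>I. f i x = 0} = zero_set n (p ` I)"
    by (auto simp: zero_set_def)
  with p show ?thesis
    unfolding closedin_zariski_topology by blast
qed

lemma closedin_fibre_condition:
  fixes B :: "'k::idom set"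
  shows "closedin (zariski_topology m) {x \<in> affine_space m. fibre_condition m B b0 b1 s e x}"
proof -
  define f where "f = (\<lambda>(b, k) x.
    coeff (smult (b0 - b1) (fibre_poly m s e x b - fibre_poly m s e x b0)) k -
    coeff [:(b0 - b) * coeff (fibre_poly m s e x b1 - fibre_poly m s e x b0) 0:] k)"
  have "fibre_condition m B b0 b1 s e x \<longleftrightarrow> (\<forall>bk\<in>B \<times> UNIV. f bk x = 0)" for x
    unfolding fibre_condition_def poly_eq_iff by (auto simp: f_def)
  moreover have "polynomial_fun m (f bk)" for bk
    unfolding f_def case_prod_unfold coeff_smult coeff_diff
    by (intro polynomial_fun_diff polynomial_fun_mult polynomial_fun_coeff_pCons
        polynomial_fun_coeff_fibre_poly polynomial_fun_const)
  ultimately show ?thesis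
    using closedin_polynomial_funs[of "B \<times> UNIV" m f] by simp
qed


section \<open>The classes below a given class\<close>

lemma closedin_points_poly_le:
  fixes B :: "'k::{alg_closed_field, field_char_0} set"
  assumes "m > 0" "finite B" "2 \<le> card B"
  shows "closedin (points_topology m) {x \<in> distinct_points m. x ` {..<m} \<le>\<^sub>p B}"
proof -
  obtain b0 b1 where b: "b0 \<in> B" "b1 \<in> B" "b0 \<noteq> b1"
    using assms(2,3) by (metis card_le_Suc0_iff_eq not_less_eq_eq numeral_2_eq_2)
  define S where "S = {s \<in> {..<m} \<rightarrow>\<^sub>E B. b0 \<in> s ` {..<m}} \<times> ({..<m} \<rightarrow>\<^sub>E {1..m})"
  define Z where "Z = (\<Union>(s, e)\<in>S. {x \<in> affine_space m. fibre_condition m B b0 b1 s e x})"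
  have "finite S"
    unfolding S_def using assms(2)
    by (intro finite_SigmaI finite_subset[OF _ finite_PiE[of "{..<m}" "\<lambda>_. B"]] finite_PiE) auto
  then have "closedin (zariski_topology m) Z"
    unfolding Z_def by (intro closedin_Union) (auto simp: closedin_fibre_condition)
  moreover have "{x \<in> distinct_points m. x ` {..<m} \<le>\<^sub>p B} = Z \<inter> distinct_points m"
  proof (intro set_eqI)
    fix x :: "nat \<Rightarrow> 'k"
    show "x \<in> {x \<in> distinct_points m. x ` {..<m} \<le>\<^sub>p B} \<longleftrightarrow> x \<in> Z \<inter> distinct_points m"
    proof (cases "x \<in> distinct_points m")
      case True
      then have x: "x \<in> affine_space m" "inj_on x {..<m}"
        by (auto simp: distinct_points_iff)
      have "x \<in> Z \<longleftrightarrow> (\<exists>s\<in>{..<m} \<rightarrow>\<^sub>E B. \<exists>e\<in>{..<m} \<rightarrow>\<^sub>E {1..m}.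
          b0 \<in> s ` {..<m} \<and> fibre_condition m B b0 b1 s e x)"
        unfolding Z_def S_def using x(1) by blast
      then show ?thesis
        using poly_le_iff_fibre_condition[OF x(2) assms(1,2) b] True by simp
    qed simp
  qed
  ultimately show ?thesis
    unfolding points_topology_def closedin_subtopology by blast
qed

theorem theorem42:
  fixes n m :: nat
    and \<Theta> :: "'k::{alg_closed_field, field_char_0} set set"
  assumes "2 \<le> n" and "n < m" and "\<Theta> \<in> classes_of_size n"
  shows "closedin (classes_topology m) (classes_below m \<Theta>)"
proof -
  obtain B where B: "\<Theta> = poly_class B" "finite B" "card B = n"
    using assms(3) by (auto simp: classes_of_size_def subsets_of_size_def)
  have "poly_class (x ` {..<m}) \<in> classes_of_size m" if "x \<in> distinct_points m" for x :: "nat \<Rightarrow> 'k"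
    using that image_distinct_points[of m] unfolding classes_of_size_def by blast
  then have "{x \<in> distinct_points m. poly_class (x ` {..<m}) \<in> classes_below m \<Theta>} =
      {x \<in> distinct_points m. x ` {..<m} \<le>\<^sub>p B}"
    by (auto simp: classes_below_def B(1) class_le_poly_class_iff)
  moreover have "classes_below m \<Theta> \<subseteq> classes_of_size m"
    by (auto simp: classes_below_def)
  moreover have "closedin (points_topology m) {x \<in> distinct_points m. x ` {..<m} \<le>\<^sub>p B}"
    using assms B by (intro closedin_points_poly_le) auto
  ultimately show ?thesis
    unfolding closedin_classes_topology by simp
qed

end
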